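(* Let $n,l,s$ be nonnegative integers with $1<f_l\le s<f_{l+1}<f_n$, and let $p$ be an integer with $0\le p<f_n$. Then (each line holding whenever its condition does) $\# P\bigl(\mathring\omega_n,s,\overline{f_{n-1}p}\bigr)$ equals \[ \begin{cases} f_n-p(s+1) & (0\le p<f_{n-l-1}),\\ f_{n-l-1}(f_{l+1}-(s+1))+f_l(f_{n-l}-p) & (f_{n-l-1}\le p<f_{n-l}),\\ (f_{l+1}-(s+1))(f_{n-l+1}-p) & (f_{n-l}\le p<f_{n-l+1}),\\ 0 & (f_{n-l+1}\le p\le f_n-f_{n-l+1}),\\ (f_{l+1}-(s+1))(f_{n-l+1}-(f_n-p)) & (f_n-f_{n-l+1}\le p\le f_n-f_{n-l}),\\ f_{n-l-1}(f_{l+1}-(s+1))+f_l(f_{n-l}-(f_n-p)) & (f_n-f_{n-l}<p\le f_n-f_{n-l-1}),\\ f_n-(f_n-p)(s+1) & (f_n-f_{n-l-1}<p<f_n). \end{cases} \]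
   Context: The Fibonacci numbers are $f_0=1$, $f_1=1$, $f_i=f_{i-1}+f_{i-2}$ for $i\ge 2$. For a positive integer $m$ let $[m]=\{1,\dots,m\}$. A word of length $m$ is a map $[m]\to\{0,1\}$, written as a sequence; $x\cdot x'$ denotes concatenation. The Fibonacci words are $\omega_0=(0)$, $\omega_1=(1)$, $\omega_n=\omega_{n-1}\cdot\omega_{n-2}$ for $n\ge2$; $\omega_n$ has length $f_n$. Let $I_n=\mathbb{Z}/f_n\mathbb{Z}$, and let $\overline{i}$ be the class of $i$. The cyclic Fibonacci word $\mathring\omega_n:I_n\to\{0,1\}$ is defined by $\mathring\omega_n(\overline{i})=\omega_n(i)$ for $i\in[f_n]$. For a map $w:I\to\{0,1\}$ with $I=\mathbb{Z}/m\mathbb{Z}$, an integer $s>0$ and $\delta\in I$, let $P(w,s)=\{(\iota,\kappa)\in I\times I : w(\iota+\overline{t-1})=w(\kappa+\overline{t-1}) \text{ for all } t\in[s]\}$ and $P(w,s,\delta)=\{(\iota,\kappa)\in P(w,s):\iota-\kappa=\delta\}$. *)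

theory Defs
  imports "HOL-Number_Theory.Number_Theory" "HOL-Library.Z2"
begin

text \<open>
  Fibonacci numbers with initial values \<open>1, 1\<close>; the library's \<^const>\<open>fib\<close> starts with
  \<open>0, 1\<close>, hence the index shift. They are taken as integers so that differences
  do not truncate.
\<close>

definition fibo :: "nat \<Rightarrow> int" where
  "fibo i = int (fib (i + 1))"

lemma fibo_0: "fibo 0 = 1"
  and fibo_1: "fibo 1 = 1"
  and fibo_rec: "i \<ge> 2 \<Longrightarrow> fibo i = fibo (i - 1) + fibo (i - 2)"
  by (auto simp: fibo_def numeral_2_eq_2 dest!: le_Suc_ex)

text \<open>The \<open>i\<close>-th letter (counting from 1) of the list \<open>w\<close> is \<open>w ! (i - 1)\<close>.\<close>

fun fib_word :: "nat \<Rightarrow> bit list" where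
  "fib_word 0 = [0]"
| "fib_word (Suc 0) = [1]"
| "fib_word (Suc (Suc n)) = fib_word (Suc n) @ fib_word n"

lemma length_fib_word: "int (length (fib_word n)) = fibo n"
  by (induction n rule: fib_word.induct) (auto simp: fibo_def)

text \<open>
  \<open>\<int>/m\<int>\<close> is \<^term>\<open>residue_ring m\<close>, with carrier \<open>{0..m - 1}\<close>; the class of an
  integer \<open>i\<close> is its representative \<open>i mod m\<close>.
\<close>

abbreviation residue_class :: "int \<Rightarrow> int \<Rightarrow> int" where
  "residue_class m i \<equiv> i mod m"

text \<open>
  Since positions in a word count from 1, the class of \<open>i\<close> is sent to the list entry with index
  \<open>i - 1\<close>; in particular the class of 0 is sent to the last letter.
\<close>

definition cyclic_fib_word :: "nat \<Rightarrow> int \<Rightarrow> bit" where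
  "cyclic_fib_word n \<iota> = fib_word n ! nat (residue_class (fibo n) (\<iota> - 1))"

lemma cyclic_fib_word_residue_class:
  assumes "i \<in> {1..length (fib_word n)}"
  shows "cyclic_fib_word n (residue_class (fibo n) (int i)) = fib_word n ! (i - 1)"
proof -
  have "(int i - 1) mod fibo n = int (i - 1)"
    using assms length_fib_word[of n] by (simp add: of_nat_diff)
  then show ?thesis
    by (simp add: cyclic_fib_word_def mod_diff_left_eq)
qed

text \<open>For a map \<open>w\<close> on \<open>\<int>/m\<int>\<close>: the sets \<open>P(w, s)\<close> and \<open>P(w, s, \<delta>)\<close>.\<close>

definition match_pairs :: "int \<Rightarrow> (int \<Rightarrow> bit) \<Rightarrow> nat \<Rightarrow> (int \<times> int) set" where
  "match_pairs m w s =
    {(\<iota>, \<kappa>) \<in> carrier (residue_ring m) \<times> carrier (residue_ring m).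
      \<forall>t\<in>{1..s}. w (\<iota> \<oplus>\<^bsub>residue_ring m\<^esub> residue_class m (int t - 1)) =
                 w (\<kappa> \<oplus>\<^bsub>residue_ring m\<^esub> residue_class m (int t - 1))}"

definition match_pairs_diff :: "int \<Rightarrow> (int \<Rightarrow> bit) \<Rightarrow> nat \<Rightarrow> int \<Rightarrow> (int \<times> int) set" where
  "match_pairs_diff m w s \<delta> =
    {(\<iota>, \<kappa>) \<in> match_pairs m w s. \<iota> \<ominus>\<^bsub>residue_ring m\<^esub> \<kappa> = \<delta>}"

end

theory Submission
  imports Defs
begin

text \<open>
  Put \<open>m = f\<^sub>n\<close> and \<open>a = f\<^sub>n\<^sub>-\<^sub>1\<close>. The cyclic Fibonacci word is a rotation word: with
  \<open>c = 0\<close> or \<open>c = -1\<close> according to the parity of \<open>n\<close>, the letter at position \<open>\<kappa>\<close> is \<open>1\<close> iff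
  the new coordinate \<open>x = (c - a \<kappa>) mod m\<close> lies in \<open>[0, a)\<close> (\<open>cyclic_fib_word_rotation\<close>).
  Moving one position to the right subtracts \<open>a\<close> from \<open>x\<close>. The factor of length \<open>s\<close> starting
  at \<open>x\<close> therefore records, for each \<open>t < s\<close>, whether \<open>x\<close> lies in the cyclic interval from
  \<open>t a\<close> to \<open>(t + 1) a\<close>, and two starting points have equal factors iff none of the \<open>s + 1\<close> cuts
  \<open>0, a, \<dots>, s a\<close> (mod \<open>m\<close>) separates them inside \<open>[0, m)\<close> (\<open>same_factor_iff_same_cuts\<close>).

  The distances between neighbouring cuts are given by a three gap theorem. The identity
  \<open>a f\<^sub>k \<equiv> (-1)\<^sup>k f\<^sub>n\<^sub>-\<^sub>1\<^sub>-\<^sub>k\<close> (mod \<open>m\<close>) says that for \<open>f\<^sub>l \<le> s + 1 \<le> f\<^sub>l\<^sub>+\<^sub>1\<close> the neighbour of a cut with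
  index \<open>j\<close> is reached by changing \<open>j\<close> by \<open>f\<^sub>l\<close>, by \<open>f\<^sub>l\<^sub>-\<^sub>1\<close> in the opposite direction, or by both.
  This produces gaps of lengths \<open>f\<^sub>n\<^sub>-\<^sub>l\<^sub>-\<^sub>1\<close>, \<open>f\<^sub>n\<^sub>-\<^sub>l\<close> and \<open>f\<^sub>n\<^sub>-\<^sub>l\<^sub>+\<^sub>1\<close>, with multiplicities
  \<open>s + 1 - f\<^sub>l\<close>, \<open>s + 1 - f\<^sub>l\<^sub>-\<^sub>1\<close> and \<open>f\<^sub>l\<^sub>+\<^sub>1 - (s + 1)\<close>. That these really are all gaps
  follows by counting (\<open>position_image\<close>, \<open>inj_position\<close>): following the successors from the cut \<open>0\<close>
  reaches every point, and the lengths add up to exactly \<open>m\<close>.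

  Finally \<open>a\<^sup>2 \<equiv> \<plusminus>1\<close>, so that the difference \<open>a p\<close> of positions is a difference \<open>\<plusminus>p\<close> of
  coordinates. A gap of length \<open>g\<close> contains \<open>max 0 (g - p)\<close> pairs \<open>(x, x + p)\<close> and
  \<open>max 0 (g - (m - p))\<close> pairs \<open>(x, x + p - m)\<close>. Summing over the gaps gives
  \<open>T p + T (m - p)\<close>, where \<open>T\<close> is piecewise linear with breaks at the three gap lengths; this
  is the asserted formula.
\<close>

section \<open>The gaps between the multiples of a residue\<close>

text \<open>
  The cuts are the multiples \<open>0, a, \<dots>, s a\<close> modulo \<open>m\<close>. Adding \<open>u\<close> to the index moves a cut by
  \<open>A\<close> to the right, and subtracting \<open>v\<close> from it moves the cut by \<open>B\<close> to the right. The bounds on \<open>s\<close>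
  say that every index admits at most one of these moves, and admits the combination of both if
  it admits neither. The equation \<open>total\<close> makes the gap lengths add up to \<open>m\<close>.
\<close>

locale rotation_gaps =
  fixes m a A B :: int and u v s :: nat
  assumes A_pos: "0 < A" and B_pos: "0 < B"
    and step_u: "[a * int u = A] (mod m)"
    and step_v: "[a * int v = - B] (mod m)"
    and total: "m = int v * A + int u * B"
    and u_le: "u \<le> s + 1" and v_le: "v \<le> s + 1" and s_less: "s + 1 \<le> u + v"
begin

definition cut :: "nat \<Rightarrow> int" where
  "cut j = (a * int j) mod m"

text \<open>The distance from the cut with index \<open>j\<close> to the next cut on its right, as
  \<open>cut_le_iff\<close> confirms; the index of that next cut is \<open>nxt j\<close>.\<close>

definition gap :: "nat \<Rightarrow> int" where
  "gap j = (if j + u \<le> s then A else if v \<le> j then B else A + B)"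

definition nxt :: "nat \<Rightarrow> nat" where
  "nxt j = (if j + u \<le> s then j + u else if v \<le> j then j - v else j + u - v)"

lemma m_pos: "0 < m"
proof -
  have "0 < u \<or> 0 < v" using s_less by auto
  then have "0 < int v * A \<or> 0 < int u * B" using A_pos B_pos by auto
  moreover have "0 \<le> int v * A" "0 \<le> int u * B" using A_pos B_pos by auto
  ultimately show ?thesis using total by linarith
qed

lemma gap_pos: "0 < gap j"
  using A_pos B_pos by (simp add: gap_def)

lemma nxt_le: "j \<le> s \<Longrightarrow> nxt j \<le> s"
  using u_le v_le s_less by (auto simp: nxt_def)

lemma cong_nxt:
  assumes "j \<le> s"
  shows "[a * int (nxt j) = a * int j + gap j] (mod m)"
proof -
  consider "j + u \<le> s" | "s < j + u" "v \<le> j" | "s < j + u" "j < v" by linarith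
  then show ?thesis
  proof cases
    case 1
    then show ?thesis using cong_add[OF cong_refl step_u, of "a * int j"]
      by (simp add: nxt_def gap_def algebra_simps)
  next
    case 2
    then show ?thesis using cong_diff[OF cong_refl step_v, of "a * int j"]
      by (simp add: nxt_def gap_def algebra_simps of_nat_diff)
  next
    case 3
    then have "v \<le> j + u" using v_le by linarith
    with 3 show ?thesis
      using cong_add[OF cong_refl cong_diff[OF step_u step_v], of "a * int j"]
      by (simp add: nxt_def gap_def algebra_simps of_nat_diff)
  qed
qed

text \<open>The indices fall into three blocks: \<open>j < s + 1 - u\<close> with gap \<open>A\<close>, then
  \<open>j < v\<close> with gap \<open>A + B\<close>, then the rest with gap \<open>B\<close>.\<close>

lemma sum_gap:
  fixes F :: "int \<Rightarrow> int"
  shows "(\<Sum>j\<le>s. F (gap j)) = (int s + 1 - int u) * F A + (int s + 1 - int v) * F B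
    + (int u + int v - (int s + 1)) * F (A + B)"
proof -
  let ?k = "s + 1 - u"
  have "?k \<le> v" using s_less by linarith
  have split: "{..s} = {..<?k} \<union> ({?k..<v} \<union> {v..<s + 1})"
    using \<open>?k \<le> v\<close> v_le by auto
  have "(\<Sum>j\<le>s. F (gap j)) = (\<Sum>j<?k. F (gap j)) + ((\<Sum>j=?k..<v. F (gap j)) + (\<Sum>j=v..<s + 1. F (gap j)))"
    unfolding split using \<open>?k \<le> v\<close>
    by (subst sum.union_disjoint; (subst sum.union_disjoint)?) auto
  also have "(\<Sum>j<?k. F (gap j)) = (\<Sum>j<?k. F A)"
    by (rule sum.cong) (auto simp: gap_def)
  also have "(\<Sum>j=?k..<v. F (gap j)) = (\<Sum>j=?k..<v. F (A + B))"
    by (rule sum.cong) (auto simp: gap_def)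
  also have "(\<Sum>j=v..<s + 1. F (gap j)) = (\<Sum>j=v..<s + 1. F B)"
    using s_less by (intro sum.cong) (auto simp: gap_def)
  finally show ?thesis
    using \<open>?k \<le> v\<close> u_le v_le s_less by (simp add: of_nat_diff algebra_simps)
qed

lemma sum_gap_total: "(\<Sum>j\<le>s. gap j) = m"
  using sum_gap[of "\<lambda>x. x"] by (simp add: total algebra_simps)

text \<open>The pair \<open>(j, r)\<close> stands for the point at distance \<open>r\<close> to the right of the cut with
  index \<open>j\<close>, in the gap that starts there.\<close>

abbreviation offsets :: "(nat \<times> int) set" where
  "offsets \<equiv> (SIGMA j:{..s}. {0..<gap j})"

text \<open>As long as the distance \<open>r\<close> is at least the gap, one can replace \<open>j\<close> by its successor and
  shorten \<open>r\<close> by the gap. So every point is in some gap.\<close>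

lemma reach:
  assumes "j \<le> s"
  shows "\<exists>(j', r') \<in> offsets. [a * int j' + r' = a * int j + int r] (mod m)"
  using assms
proof (induction r arbitrary: j rule: less_induct)
  case (less r)
  show ?case
  proof (cases "int r < gap j")
    case True
    then show ?thesis using less.prems by (intro bexI[of _ "(j, int r)"]) auto
  next
    case False
    define r1 where "r1 = nat (int r - gap j)"
    have r1: "int r1 = int r - gap j" using False by (simp add: r1_def)
    then have "r1 < r" using gap_pos[of j] by linarith
    then obtain j' r' where "(j', r') \<in> offsets"
      "[a * int j' + r' = a * int (nxt j) + int r1] (mod m)"
      using less.IH nxt_le[OF less.prems] by blast
    moreover have "[a * int (nxt j) + int r1 = a * int j + int r] (mod m)"
      using cong_add[OF cong_nxt[OF less.prems] cong_refl, of "int r1"] by (simp add: r1)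
    ultimately show ?thesis using cong_trans by blast
  qed
qed

text \<open>The three gap theorem. By \<open>reach\<close> the map is onto; since there are as many offsets as points,
  it is also injective, so that the gaps tile the cycle.\<close>

lemma inj_position: "inj_on (\<lambda>(j, r). (a * int j + r) mod m) offsets"
  and position_image: "(\<lambda>(j, r). (a * int j + r) mod m) ` offsets = {0..<m}"
proof -
  let ?f = "\<lambda>(j, r). (a * int j + r) mod m"
  have "int (card offsets) = (\<Sum>j\<le>s. int (nat (gap j)))"
    by simp
  also have "\<dots> = (\<Sum>j\<le>s. gap j)"
    using gap_pos by (intro sum.cong) (auto simp: less_imp_le)
  finally have "int (card offsets) = m" by (simp add: sum_gap_total)
  moreover have "int (card {0..<m}) = m" using m_pos by simp
  ultimately have card: "card offsets = card {0..<m}"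
    by linarith
  show img: "?f ` offsets = {0..<m}"
  proof
    show "?f ` offsets \<subseteq> {0..<m}" using m_pos by auto
    show "{0..<m} \<subseteq> ?f ` offsets"
    proof
      fix x assume x: "x \<in> {0..<m}"
      then obtain j r where "(j, r) \<in> offsets" "[a * int j + r = x] (mod m)"
        using reach[of 0 "nat x"] by auto
      then show "x \<in> ?f ` offsets" using x
        by (intro image_eqI[of _ _ "(j, r)"]) (auto simp: cong_def)
    qed
  qed
  show "inj_on ?f offsets"
    by (rule eq_card_imp_inj_on) (auto simp: img card)
qed

lemma position_unique:
  assumes "[a * int j + r = a * int k + q] (mod m)"
    and "j \<le> s" "0 \<le> r" "r < gap j" "k \<le> s" "0 \<le> q" "q < gap k"
  shows "j = k \<and> r = q"
  using inj_onD[OF inj_position, of "(j, r)" "(k, q)"] assms by (auto simp: cong_def)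

lemma cut_range: "0 \<le> cut j" "cut j < m"
  using m_pos by (auto simp: cut_def)

lemma cut_cong: "[cut j = a * int j] (mod m)"
  by (simp add: cut_def)

lemma cut_0: "cut 0 = 0"
  by (simp add: cut_def)

text \<open>No gap runs over the end of \<open>[0, m)\<close>, because \<open>0\<close> is a cut. The gaps are thus ordinary
  intervals of integers, and the linear order decides in which of them a point lies.\<close>

lemma gap_within:
  assumes "j \<le> s" "0 \<le> r" "r < gap j"
  shows "cut j + r < m"
proof (rule ccontr)
  assume "\<not> cut j + r < m"
  define q where "q = m - cut j"
  have q: "0 < q" "q < gap j" using \<open>\<not> cut j + r < m\<close> assms cut_range[of j] by (auto simp: q_def)
  have "[a * int j + q = a * int 0 + 0] (mod m)"
    using cong_add[OF cong_sym[OF cut_cong[of j]] cong_refl, of q] by (simp add: q_def cong_def)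
  then show False using position_unique[of j q 0 0] assms q gap_pos[of 0] by auto
qed

lemma cut_le_iff:
  assumes "j \<le> s" "0 \<le> r" "r < gap j" "k \<le> s"
  shows "cut k \<le> cut j + r \<longleftrightarrow> cut k \<le> cut j"
proof (rule iffI, rule ccontr)
  assume "cut k \<le> cut j + r" "\<not> cut k \<le> cut j"
  define q where "q = cut k - cut j"
  have q: "0 < q" "q < gap j" using \<open>cut k \<le> cut j + r\<close> \<open>\<not> cut k \<le> cut j\<close> assms
    by (auto simp: q_def)
  have "[a * int j + q = a * int k + 0] (mod m)"
    using cong_add[OF cong_sym[OF cut_cong[of j]] cong_refl, of q] cut_cong[of k]
    by (simp add: q_def cong_def)
  then show False using position_unique[of j q k 0] assms q gap_pos[of k] by auto
qed (use assms in auto)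

lemma cut_inj: "j \<le> s \<Longrightarrow> k \<le> s \<Longrightarrow> cut j = cut k \<Longrightarrow> j = k"
  using position_unique[of j 0 k 0] gap_pos by (auto simp: cut_def cong_def)

lemma obtain_gap:
  assumes "0 \<le> x" "x < m"
  obtains j r where "j \<le> s" "0 \<le> r" "r < gap j" "x = cut j + r"
proof -
  obtain j r where jr: "(j, r) \<in> offsets" "x = (a * int j + r) mod m"
    using position_image assms by (metis (mono_tags, lifting) atLeastLessThan_iff imageE case_prod_beta prod.collapse)
  then have "x = (cut j + r) mod m" by (simp add: cut_def mod_add_left_eq)
  moreover have "(cut j + r) mod m = cut j + r"
    using jr gap_within cut_range[of j] by (intro mod_pos_pos_trivial) auto
  ultimately show ?thesis using that jr by auto
qed

definition same_gap :: "int \<Rightarrow> int \<Rightarrow> bool" where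
  "same_gap x y \<longleftrightarrow> (\<forall>k\<le>s. cut k \<le> x \<longleftrightarrow> cut k \<le> y)"

lemma same_gap_sym: "same_gap x y \<longleftrightarrow> same_gap y x"
  by (auto simp: same_gap_def)

text \<open>Two points with the same cuts below them have the same largest cut below them.\<close>

lemma same_gap_iff:
  assumes "j \<le> s" "0 \<le> r" "r < gap j" "k \<le> s" "0 \<le> q" "q < gap k"
  shows "same_gap (cut j + r) (cut k + q) \<longleftrightarrow> j = k"
proof
  assume *: "same_gap (cut j + r) (cut k + q)"
  have "cut j \<le> cut k" "cut k \<le> cut j"
    using * assms by (auto simp: same_gap_def cut_le_iff)
  then show "j = k" using cut_inj assms by auto
qed (use assms in \<open>auto simp: same_gap_def cut_le_iff\<close>)

section \<open>Counting pairs inside the gaps\<close>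

definition pairs_at :: "int \<Rightarrow> nat" where
  "pairs_at q = card {x. 0 \<le> x \<and> x + q < m \<and> same_gap x (x + q)}"

text \<open>A gap of length \<open>g\<close> contains both \<open>x\<close> and \<open>x + q\<close> for \<open>max 0 (g - q)\<close> points \<open>x\<close>.\<close>

lemma pairs_at_eq:
  assumes "0 \<le> q"
  shows "int (pairs_at q) = (int s + 1 - int u) * max 0 (A - q)
    + (int s + 1 - int v) * max 0 (B - q) + (int u + int v - (int s + 1)) * max 0 (A + B - q)"
proof -
  let ?S = "SIGMA j:{..s}. {0..<gap j - q}"
  let ?f = "\<lambda>(j, r). cut j + r"
  have "bij_betw ?f ?S {x. 0 \<le> x \<and> x + q < m \<and> same_gap x (x + q)}"
  proof (rule bij_betw_imageI)
    show "inj_on ?f ?S"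
    proof (rule inj_onI, clarsimp)
      fix j r k t
      assume *: "j \<le> s" "k \<le> s" "0 \<le> r" "r < gap j - q" "0 \<le> t" "t < gap k - q" "cut j + r = cut k + t"
      have "same_gap (cut j + r) (cut k + t)" using * by (simp add: same_gap_def)
      then have "j = k" using same_gap_iff[of j r k t] * assms by auto
      then show "j = k \<and> r = t" using * by simp
    qed
    show "?f ` ?S = {x. 0 \<le> x \<and> x + q < m \<and> same_gap x (x + q)}"
    proof (intro equalityI subsetI)
      fix x assume "x \<in> ?f ` ?S"
      then obtain j r where *: "j \<le> s" "0 \<le> r" "r < gap j - q" "x = cut j + r" by auto
      then show "x \<in> {x. 0 \<le> x \<and> x + q < m \<and> same_gap x (x + q)}"
        using gap_within[of j "r + q"] same_gap_iff[of j r j "r + q"] cut_range[of j] assms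
        by (simp add: add.assoc)
    next
      fix x assume "x \<in> {x. 0 \<le> x \<and> x + q < m \<and> same_gap x (x + q)}"
      then have x: "0 \<le> x" "x + q < m" "same_gap x (x + q)" by auto
      obtain j r where j: "j \<le> s" "0 \<le> r" "r < gap j" "x = cut j + r"
        using obtain_gap[of x] x assms by auto
      obtain k t where k: "k \<le> s" "0 \<le> t" "t < gap k" "x + q = cut k + t"
        using obtain_gap[of "x + q"] x assms by auto
      have "j = k" using same_gap_iff[of j r k t] x j k by simp
      then have "r < gap j - q" using j k by auto
      then show "x \<in> ?f ` ?S" using j by (intro image_eqI[of _ _ "(j, r)"]) auto
    qed
  qed
  then have "card ?S = pairs_at q"
    unfolding pairs_at_def by (rule bij_betw_same_card)
  then have "int (pairs_at q) = int (\<Sum>j\<le>s. nat (gap j - q))"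
    by simp
  also have "\<dots> = (\<Sum>j\<le>s. int (nat (gap j - q)))"
    by (rule of_nat_sum)
  also have "\<dots> = (\<Sum>j\<le>s. max 0 (gap j - q))"
    by (intro sum.cong) auto
  finally show ?thesis using sum_gap[of "\<lambda>g. max 0 (g - q)"] by simp
qed

text \<open>If \<open>x + p\<close> runs over the end of the cycle, then the pair \<open>(x, x + p - m)\<close> is a pair at
  distance \<open>m - p\<close> in the opposite order.\<close>

lemma cyclic_pairs_eq:
  assumes "0 \<le> p" "p \<le> m"
  shows "card {x \<in> {0..<m}. same_gap x ((x + p) mod m)} = pairs_at p + pairs_at (m - p)"
proof -
  let ?lo = "{x. 0 \<le> x \<and> x + p < m \<and> same_gap x (x + p)}"
  let ?hi = "{x \<in> {0..<m}. m \<le> x + p \<and> same_gap x (x + p - m)}"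
  let ?hi' = "{x. 0 \<le> x \<and> x + (m - p) < m \<and> same_gap x (x + (m - p))}"
  have wrap: "(x + p) mod m = x + p - m" if "x < m" "m \<le> x + p" for x
    using that assms mod_pos_pos_trivial[of "x + p - m" m] by simp
  have "{x \<in> {0..<m}. same_gap x ((x + p) mod m)} = ?lo \<union> ?hi"
  proof (rule Set.set_eqI)
    fix x show "x \<in> {x \<in> {0..<m}. same_gap x ((x + p) mod m)} \<longleftrightarrow> x \<in> ?lo \<union> ?hi"
      using assms wrap[of x] by (cases "x + p < m") auto
  qed
  moreover have "finite ?lo" by (rule finite_subset[of _ "{0..<m}"]) (use assms in auto)
  moreover have "finite ?hi" by (rule finite_subset[of _ "{0..<m}"]) auto
  moreover have "?lo \<inter> ?hi = {}" by auto
  ultimately have "card {x \<in> {0..<m}. same_gap x ((x + p) mod m)} = card ?lo + card ?hi"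
    by (simp add: card_Un_disjoint)
  also have "card ?hi = card ?hi'"
  proof (rule bij_betw_same_card)
    have "?hi' = {x. 0 \<le> x \<and> x < p \<and> same_gap (x + (m - p)) x}"
      by (simp add: same_gap_sym[of "_ + (m - p)"])
    then show "bij_betw (\<lambda>x. x + p - m) ?hi ?hi'"
      using assms by (simp only:) (rule bij_betw_byWitness[where f' = "\<lambda>x. x + (m - p)"]; force)
  qed
  finally show ?thesis by (simp add: pairs_at_def)
qed

section \<open>Neighbours of 0 and factors of rotation words\<close>

text \<open>The gap to the right of the cut \<open>0\<close> has at least length \<open>A\<close>. The gap to its left begins at
  the cut with index \<open>v\<close> and has length \<open>B\<close>.\<close>

lemma not_cong_right_of_0:
  assumes "0 < j" "j \<le> s" "u \<le> s" "0 \<le> r" "r < A"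
  shows "\<not> [a * int j = r] (mod m)"
  using position_unique[of j 0 0 r] gap_pos[of j] assms by (auto simp: gap_def)

lemma not_cong_left_of_0:
  assumes "0 < j" "j \<le> s" "v \<le> s" "0 \<le> r" "r < B"
  shows "\<not> [a * int j = - r] (mod m)"
proof
  assume *: "[a * int j = - r] (mod m)"
  show False
  proof (cases "r = 0")
    case True
    then show False using * position_unique[of j 0 0 0] gap_pos[of j] gap_pos[of 0] assms by auto
  next
    case False
    have gv: "gap v = B" using s_less by (simp add: gap_def)
    have "[a * int v + (B - r) = - r] (mod m)"
      using cong_add[OF step_v cong_refl, of "B - r"] by simp
    then have "[a * int j + 0 = a * int v + (B - r)] (mod m)"
      using * by (simp add: cong_def)
    then show False
      using position_unique[of j 0 v "B - r"] gap_pos[of j] gv assms False by auto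
  qed
qed

text \<open>
  The letter at time \<open>k\<close> tells whether \<open>x\<close> is in the cyclic interval from the cut \<open>k\<close> to the cut
  \<open>k + 1\<close>. Once it is known on which side of the cut \<open>k\<close> the point lies, this letter carries
  exactly the information on which side of the cut \<open>k + 1\<close> it lies. For \<open>k = 0\<close> there are no
  letters, and the only cut is \<open>0\<close>, which is below every point.
\<close>

lemma same_factor_iff_same_cuts:
  assumes "0 \<le> a" "a < m" "0 \<le> x" "x < m" "0 \<le> y" "y < m"
  shows "(\<forall>t<k. (x - a * int t) mod m < a \<longleftrightarrow> (y - a * int t) mod m < a) \<longleftrightarrow>
    (\<forall>j\<le>k. cut j \<le> x \<longleftrightarrow> cut j \<le> y)"
proof (induction k)
  case 0
  then show ?case using assms by (simp add: cut_0)
next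
  case (Suc k)
  \<comment> \<open>The interval wraps around exactly if the next cut is not to the right of the present one.\<close>
  have letter: "(z - a * int k) mod m < a \<longleftrightarrow>
      (if cut k + a < m then cut k \<le> z \<and> z < cut (Suc k) else cut k \<le> z \<or> z < cut (Suc k))"
    and next_cut: "cut (Suc k) = (if cut k + a < m then cut k + a else cut k + a - m)"
    if "0 \<le> z" "z < m" for z
  proof -
    have "cut (Suc k) = (cut k + a) mod m"
      by (simp add: cut_def algebra_simps mod_add_left_eq mod_add_right_eq)
    then show *: "cut (Suc k) = (if cut k + a < m then cut k + a else cut k + a - m)"
      using assms cut_range[of k] mod_pos_pos_trivial[of "cut k + a - m" m] by auto
    have "(z - a * int k) mod m = (z - cut k) mod m"
      by (simp add: cut_def mod_diff_right_eq)
    also have "\<dots> = (if cut k \<le> z then z - cut k else z - cut k + m)"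
      using that cut_range[of k] mod_pos_pos_trivial[of "z - cut k + m" m]
      by (auto simp: mod_pos_pos_trivial)
    finally show "(z - a * int k) mod m < a \<longleftrightarrow>
      (if cut k + a < m then cut k \<le> z \<and> z < cut (Suc k) else cut k \<le> z \<or> z < cut (Suc k))"
      using * that cut_range[of k] assms by auto
  qed
  have step: "((x - a * int k) mod m < a \<longleftrightarrow> (y - a * int k) mod m < a) \<longleftrightarrow>
      (cut (Suc k) \<le> x \<longleftrightarrow> cut (Suc k) \<le> y)" if "cut k \<le> x \<longleftrightarrow> cut k \<le> y"
    using that letter[of x] letter[of y] next_cut[of x] assms by (auto split: if_splits)
  show ?case
    unfolding less_Suc_eq le_Suc_eq using Suc.IH step by (metis order_refl)
qed

end

section \<open>Gaps of Fibonacci rotations\<close>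

lemma fibo_pos: "0 < fibo k"
  by (simp add: fibo_def fib_neq_0_nat)

lemma fibo_Suc_Suc: "fibo (Suc (Suc k)) = fibo (Suc k) + fibo k"
  by (simp add: fibo_def)

lemma fibo_mono: "j \<le> k \<Longrightarrow> fibo j \<le> fibo k"
  by (simp add: fibo_def fib_mono)

lemma fibo_less_Suc:
  assumes "0 < k" shows "fibo k < fibo (Suc k)"
  using fibo_pos[of "k - 1"] fibo_Suc_Suc[of "k - 1"] assms by simp

text \<open>This is d'Ocagne's identity modulo \<open>f\<^sub>N\<^sub>+\<^sub>1\<close>. Both sides satisfy the Fibonacci recurrence in \<open>k\<close>,
  the right one because the signs alternate while the indices decrease. For \<open>k = N\<close> it is
  Cassini's identity \<open>f\<^sub>N\<^sup>2 \<equiv> \<plusminus>1\<close>.\<close>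

lemma fibo_mult_cong:
  assumes "k \<le> N"
  shows "[fibo N * fibo k = (-1) ^ k * fibo (N - k)] (mod fibo (Suc N))"
  using assms
proof (induction k rule: fib.induct)
  case 1
  then show ?case by (simp add: fibo_0)
next
  case 2
  then obtain M where "N = Suc M" by (cases N) auto
  then have "fibo N * fibo 1 = (-1) ^ 1 * fibo (N - 1) + fibo (Suc N)"
    by (simp add: fibo_1[unfolded One_nat_def] fibo_Suc_Suc)
  then show ?case by (simp add: cong_def)
next
  case (3 k)
  define d where "d = N - Suc (Suc k)"
  have d: "N - Suc k = Suc d" "N - k = Suc (Suc d)" using 3 by (auto simp: d_def)
  have "[fibo N * fibo (Suc k) + fibo N * fibo k
      = (-1) ^ Suc k * fibo (N - Suc k) + (-1) ^ k * fibo (N - k)] (mod fibo (Suc N))"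
    using 3 by (intro cong_add) auto
  then show ?case
    unfolding d d_def[symmetric] by (simp add: fibo_Suc_Suc algebra_simps)
qed

lemma fibo_total:
  assumes "1 \<le> l" "l \<le> N"
  shows "fibo (Suc N) = fibo l * fibo (Suc (N - l)) + fibo (l - 1) * fibo (N - l)"
  using fib_add[of "Suc (N - l)" l] assms
  by (simp add: fibo_def algebra_simps Suc_diff_le flip: of_nat_mult of_nat_add)

text \<open>By \<open>fibo_mult_cong\<close>, the steps \<open>f\<^sub>l\<close> and \<open>f\<^sub>l\<^sub>-\<^sub>1\<close> move a point in opposite directions. The parity
  of \<open>l\<close> decides which of them is the step \<open>u\<close> to the right.\<close>

lemma rotation_gaps_even:
  assumes "even l" "1 \<le> l" "l \<le> N" "fibo l \<le> int s + 1" "int s + 1 \<le> fibo (Suc l)"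
  shows "rotation_gaps (fibo (Suc N)) (fibo N) (fibo (N - l)) (fibo (Suc (N - l)))
    (fib (Suc l)) (fib l) s"
proof
  obtain k where k: "l = Suc k" using assms by (cases l) auto
  have u: "int (fib (Suc l)) = fibo l" and v: "int (fib l) = fibo (l - 1)"
    using k by (simp_all add: fibo_def)
  show "[fibo N * int (fib (Suc l)) = fibo (N - l)] (mod fibo (Suc N))"
    using fibo_mult_cong[of l N] assms by (simp add: u)
  show "[fibo N * int (fib l) = - fibo (Suc (N - l))] (mod fibo (Suc N))"
    using fibo_mult_cong[of "l - 1" N] assms k v by (simp add: Suc_diff_Suc)
  show "fibo (Suc N) = int (fib l) * fibo (N - l) + int (fib (Suc l)) * fibo (Suc (N - l))"
    using fibo_total[of l N] assms unfolding u v by simp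
  show "fib (Suc l) \<le> s + 1" "fib l \<le> s + 1" "s + 1 \<le> fib (Suc l) + fib l"
    using assms u v fibo_mono[of "l - 1" l] fibo_Suc_Suc[of k] k by simp_all
qed (simp_all add: fibo_pos)

lemma rotation_gaps_odd:
  assumes "odd l" "l \<le> N" "fibo l \<le> int s + 1" "int s + 1 \<le> fibo (Suc l)"
  shows "rotation_gaps (fibo (Suc N)) (fibo N) (fibo (Suc (N - l))) (fibo (N - l))
    (fib l) (fib (Suc l)) s"
proof
  obtain k where k: "l = Suc k" using assms by (cases l) auto
  have u: "int (fib (Suc l)) = fibo l" and v: "int (fib l) = fibo (l - 1)"
    using k by (simp_all add: fibo_def)
  show "[fibo N * int (fib (Suc l)) = - fibo (N - l)] (mod fibo (Suc N))"
    using fibo_mult_cong[of l N] assms by (simp add: u)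
  show "[fibo N * int (fib l) = fibo (Suc (N - l))] (mod fibo (Suc N))"
    using fibo_mult_cong[of "l - 1" N] assms k v by (simp add: Suc_diff_Suc)
  show "fibo (Suc N) = int (fib (Suc l)) * fibo (Suc (N - l)) + int (fib l) * fibo (N - l)"
    using fibo_total[of l N] assms k unfolding u v by simp
  show "fib (Suc l) \<le> s + 1" "fib l \<le> s + 1" "s + 1 \<le> fib l + fib (Suc l)"
    using assms u v fibo_mono[of "l - 1" l] fibo_Suc_Suc[of k] k by simp_all
qed (simp_all add: fibo_pos)

section \<open>Fibonacci words are rotation words\<close>

text \<open>Moving to the right changes the letter only on arrival at one of the ends \<open>0\<close> and \<open>a\<close> of the
  interval \<open>[0, a)\<close>.\<close>

lemma rotation_letter_const:
  fixes a m z :: int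
  assumes "0 \<le> a" "a < m"
    and "\<And>r. 0 < r \<Longrightarrow> r \<le> int d \<Longrightarrow> \<not> [z + r = 0] (mod m) \<and> \<not> [z + r = a] (mod m)"
  shows "(z + int d) mod m < a \<longleftrightarrow> z mod m < a"
  using assms(3)
proof (induction d)
  case (Suc d)
  let ?y = "(z + int d) mod m"
  have "(z + int (Suc d)) mod m = (?y + 1) mod m"
    by (simp add: mod_add_right_eq ac_simps)
  moreover have "(z + int (Suc d)) mod m \<noteq> 0" "(z + int (Suc d)) mod m \<noteq> a"
    using Suc.prems[of "int (Suc d)"] assms by (auto simp: cong_def)
  moreover have "0 \<le> ?y" "?y < m" using assms by auto
  ultimately have "(z + int (Suc d)) mod m < a \<longleftrightarrow> ?y < a"
    by (cases "?y + 1 = m") auto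
  then show ?case using Suc.IH Suc.prems by auto
qed simp

text \<open>The point of the rotation modulo \<open>f\<^sub>N\<^sub>+\<^sub>1\<close> that belongs to position \<open>0\<close>. The dependence on the
  parity comes from Cassini's identity: by it the point with index \<open>f\<^sub>N\<close> is a neighbour of this
  one, on the right or on the left, and the two have to be in the interval \<open>[0, f\<^sub>N)\<close> or outside of it
  as the last letters of \<open>\<omega>\<^sub>N\<close> and \<open>\<omega>\<^sub>N\<^sub>+\<^sub>1\<close> require.\<close>

definition phase :: "nat \<Rightarrow> int" where
  "phase N = (if even N then 0 else -1)"

text \<open>
  The rotation word has the same letters at \<open>i\<close> and \<open>i + f\<^sub>k\<close> for \<open>1 \<le> i \<le> f\<^sub>k\<^sub>-\<^sub>1\<close>. The shift by \<open>f\<^sub>k\<close>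
  moves the point by \<open>e = f\<^sub>N\<^sub>-\<^sub>k\<close> only, to the left for even \<open>k\<close> and to the right for odd
  \<open>k\<close>. The letter could only change if the point crossed one of the ends \<open>0\<close> and \<open>f\<^sub>N\<close> of the
  interval, and then \<open>i f\<^sub>N\<close> or \<open>(i + 1) f\<^sub>N\<close> would be so close to \<open>0\<close> modulo \<open>f\<^sub>N\<^sub>+\<^sub>1\<close> that it falls
  into the gap of length \<open>f\<^sub>N\<^sub>-\<^sub>k\<^sub>+\<^sub>1\<close> next to \<open>0\<close>. The cuts considered here are the multiples with
  index at most \<open>f\<^sub>k\<close>.
\<close>

lemma rotation_letter_period:
  assumes "2 \<le> k" "k \<le> N" "1 \<le> i" "int i \<le> fibo (k - 1)"
  shows "(phase N - fibo N * (int i + fibo k)) mod fibo (Suc N) < fibo N \<longleftrightarrow>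
    (phase N - fibo N * int i) mod fibo (Suc N) < fibo N"
proof -
  let ?m = "fibo (Suc N)" and ?a = "fibo N"
  define e where "e = fibo (N - k)"
  define y where "y = phase N - ?a * int i"
  have e_int: "int (nat e) = e" using fibo_pos[of "N - k"] by (simp add: e_def)
  have am: "0 \<le> ?a" "?a < ?m" using fibo_pos[of N] fibo_less_Suc[of N] assms by auto
  have fk: "fibo k = fibo (k - 1) + fibo (k - 2)" "fibo (Suc k) = fibo k + fibo (k - 1)"
    using fibo_Suc_Suc[of "k - 2"] fibo_Suc_Suc[of "k - 1"] assms
    by (simp_all add: Suc_diff_Suc numeral_2_eq_2)
  have s_fib: "int (fib (Suc k)) = fibo k" by (simp add: fibo_def)
  have i1: "i + 1 \<le> fib (Suc k)"
    using assms fk fibo_pos[of "k - 2"] s_fib by linarith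
  have range: "fibo k \<le> int (fib (Suc k)) + 1" "int (fib (Suc k)) + 1 \<le> fibo (Suc k)"
    using s_fib fk fibo_pos[of "k - 1"] by auto
  have e_le: "e \<le> fibo (Suc (N - k))" and e_less: "k < N \<Longrightarrow> e < fibo (Suc (N - k))"
    unfolding e_def using fibo_mono[of "N - k" "Suc (N - k)"] fibo_less_Suc[of "N - k"] by auto
  have fib_le: "fib k \<le> fib (Suc k)" by (simp add: fib_mono)
  \<comment> \<open>If the end \<open>b f\<^sub>N\<close> of the interval, with \<open>b = 0\<close> or \<open>b = 1\<close>, is at distance \<open>r\<close> from \<open>y\<close>, then
    the multiple with index \<open>i + b\<close> is near \<open>0\<close>.\<close>
  have hit: "[?a * int j = phase N + r] (mod ?m)"
    if "[y + r = ?a * int b] (mod ?m)" "j = i + b" for r b j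
    using cong_add[OF that(1) cong_refl, of "?a * int i"] that(2)
    by (simp add: y_def algebra_simps cong_sym_eq)
  show ?thesis
  proof (cases "even k")
    case True
    interpret rotation_gaps ?m ?a "fibo (N - k)" "fibo (Suc (N - k))" "fib (Suc k)" "fib k" "fib (Suc k)"
      using rotation_gaps_even[OF True _ _ range] assms by simp
    have no: "\<not> [?a * int j = phase N + (r - e)] (mod ?m)" if "0 < r" "r \<le> e" "j \<in> {i, i + 1}" for r j
    proof -
      define t where "t = e - r - phase N"
      \<comment> \<open>For \<open>k = N\<close> the gap has length \<open>1 = e\<close>; then \<open>N\<close> is even, and \<open>phase N = 0\<close> keeps \<open>t\<close> below \<open>1\<close>.\<close>
      have "0 \<le> t" "t < fibo (Suc (N - k))"
        using that e_le e_less True assms by (cases "k = N"; auto simp: phase_def t_def)+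
      then have "\<not> [?a * int j = - t] (mod ?m)"
        using that i1 assms fib_le by (intro not_cong_left_of_0) auto
      then show ?thesis by (simp add: t_def algebra_simps)
    qed
    have "(y - e + int (nat e)) mod ?m < ?a \<longleftrightarrow> (y - e) mod ?m < ?a"
    proof (rule rotation_letter_const[OF am], intro conjI notI)
      fix r assume r: "0 < r" "r \<le> int (nat e)"
      show False if "[y - e + r = 0] (mod ?m)"
        using hit[of "r - e" 0 i] no[of r i] that r e_int by (simp add: algebra_simps)
      show False if "[y - e + r = ?a] (mod ?m)"
        using hit[of "r - e" 1 "i + 1"] no[of r "i + 1"] that r e_int by (simp add: algebra_simps)
    qed
    moreover have "[phase N - ?a * (int i + fibo k) = y - e] (mod ?m)"
      using cong_diff[OF cong_refl fibo_mult_cong[of k N], of y] assms True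
      by (simp add: y_def e_def algebra_simps)
    ultimately show ?thesis unfolding e_int by (simp add: y_def cong_def)
  next
    case False
    interpret rotation_gaps ?m ?a "fibo (Suc (N - k))" "fibo (N - k)" "fib k" "fib (Suc k)" "fib (Suc k)"
      using rotation_gaps_odd[OF False _ range] assms by simp
    have no: "\<not> [?a * int j = phase N + r] (mod ?m)" if "0 < r" "r \<le> e" "j \<in> {i, i + 1}" for r j
    proof -
      have "phase N = 0 \<or> phase N = - 1" "k = N \<Longrightarrow> phase N = - 1"
        using False by (auto simp: phase_def)
      \<comment> \<open>For \<open>k = N\<close> the gap has length \<open>1 = e\<close>; the phase \<open>-1\<close> compensates for \<open>r = e\<close>.\<close>
      then have "0 \<le> phase N + r" "phase N + r < fibo (Suc (N - k))"
        using that(1,2) e_le e_less assms(2) by linarith+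
      then show ?thesis
        using that i1 assms fib_le by (intro not_cong_right_of_0) auto
    qed
    have "(y + int (nat e)) mod ?m < ?a \<longleftrightarrow> y mod ?m < ?a"
    proof (rule rotation_letter_const[OF am], intro conjI notI)
      fix r assume r: "0 < r" "r \<le> int (nat e)"
      show False if "[y + r = 0] (mod ?m)"
        using hit[of r 0 i] no[of r i] that r e_int by simp
      show False if "[y + r = ?a] (mod ?m)"
        using hit[of r 1 "i + 1"] no[of r "i + 1"] that r e_int by simp
    qed
    moreover have "[phase N - ?a * (int i + fibo k) = y + e] (mod ?m)"
      using cong_diff[OF cong_refl fibo_mult_cong[of k N], of y] assms False
      by (simp add: y_def e_def algebra_simps)
    ultimately show ?thesis unfolding e_int by (simp add: y_def cong_def)
  qed
qed

text \<open>
  One rotation, modulo \<open>f\<^sub>N\<^sub>+\<^sub>1\<close>, describes all words \<open>\<omega>\<^sub>k\<close> with \<open>1 \<le> k \<le> N + 1\<close>. Keeping the modulus while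
  \<open>k\<close> varies reduces the recursion \<open>\<omega>\<^sub>k = \<omega>\<^sub>k\<^sub>-\<^sub>1 \<cdot> \<omega>\<^sub>k\<^sub>-\<^sub>2\<close> to \<open>rotation_letter_period\<close>. The word \<open>\<omega>\<^sub>0\<close>
  is not a prefix of the others, so that the induction starts with \<open>\<omega>\<^sub>1\<close> and \<open>\<omega>\<^sub>2\<close>.
\<close>

lemma fib_word_rotation:
  assumes "1 \<le> k" "k \<le> Suc N" "1 \<le> N" "1 \<le> i" "int i \<le> fibo k"
  shows "fib_word k ! (i - 1) = 1 \<longleftrightarrow>
    (phase N - fibo N * int i) mod fibo (Suc N) < fibo N"
  using assms(1,2,4,5)
proof (induction k arbitrary: i rule: less_induct)
  case (less k)
  have m: "fibo (Suc N) = fibo N + fibo (N - 1)" and N1: "fibo (N - 1) \<le> fibo N"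
    and N1': "even N \<Longrightarrow> fibo (N - 1) < fibo N"
    using fibo_Suc_Suc[of "N - 1"] fibo_mono[of "N - 1" N] fibo_less_Suc[of "N - 1"] assms(3)
    by (auto simp: odd_pos elim!: evenE)
  have first: "(phase N - fibo N) mod fibo (Suc N) < fibo N"
  proof -
    have "(phase N - fibo N) mod fibo (Suc N) = (phase N - fibo N + fibo (Suc N)) mod fibo (Suc N)"
      by simp
    also have "phase N - fibo N + fibo (Suc N) = phase N + fibo (N - 1)"
      by (simp add: m)
    also have "\<dots> mod fibo (Suc N) = \<dots>"
      using m fibo_pos[of "N - 1"] fibo_pos[of N] by (intro mod_pos_pos_trivial) (auto simp: phase_def)
    finally show ?thesis using N1 N1' by (auto simp: phase_def)
  qed
  consider "k = 1" | "k = 2" | "3 \<le> k" using less.prems by linarith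
  then show ?case
  proof cases
    case 1
    then have "i = 1" using less.prems by (simp add: fibo_def)
    then show ?thesis using first 1 by simp
  next
    case 2
    then consider "i = 1" | "i = 2" using less.prems by (force simp: fibo_def numeral_2_eq_2)
    then show ?thesis
    proof cases
      case 1
      then show ?thesis using first 2 by (simp add: numeral_2_eq_2)
    next
      case i: 2
      have "fibo N \<le> (phase N - fibo N * 2) mod fibo (Suc N)"
      proof (cases "N = 1")
        case True
        then show ?thesis by (simp add: phase_def fibo_def)
      next
        case False
        then have N3: "odd N \<Longrightarrow> 2 < N" using assms(3) by presburger
        have N2: "fibo N = fibo (N - 1) + fibo (N - 2)" "fibo (N - 2) \<le> fibo (N - 1)"
            "odd N \<Longrightarrow> fibo (N - 2) < fibo (N - 1)"
          using fibo_Suc_Suc[of "N - 2"] fibo_mono[of "N - 2" "N - 1"] fibo_less_Suc[of "N - 2"] assms(3)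
            False N3
          by (auto simp: Suc_diff_Suc numeral_2_eq_2)
        have "(phase N - fibo N * 2) mod fibo (Suc N)
            = (phase N - fibo N * 2 + 2 * fibo (Suc N)) mod fibo (Suc N)"
          by simp
        also have "phase N - fibo N * 2 + 2 * fibo (Suc N) = phase N + 2 * fibo (N - 1)"
          by (simp add: m)
        also have "\<dots> mod fibo (Suc N) = \<dots>"
          using m N2 fibo_pos[of "N - 1"] fibo_pos[of "N - 2"]
          by (intro mod_pos_pos_trivial) (auto simp: phase_def)
        finally show ?thesis using N2 by (auto simp: phase_def)
      qed
      then show ?thesis using i 2 by (simp add: numeral_2_eq_2)
    qed
  next
    case 3
    then obtain j where j: "k = Suc (Suc j)" "1 \<le> j"
      by (metis Suc_le_D Suc_le_mono numeral_3_eq_3 One_nat_def)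
    have len: "int (length (fib_word (Suc j))) = fibo (Suc j)" by (rule length_fib_word)
    show ?thesis
    proof (cases "int i \<le> fibo (Suc j)")
      case True
      then have "i - 1 < length (fib_word (Suc j))"
        using len less.prems by linarith
      then have "fib_word k ! (i - 1) = fib_word (Suc j) ! (i - 1)"
        using j by (simp add: nth_append)
      then show ?thesis using less.IH[of "Suc j" i] less.prems j True by simp
    next
      case False
      define i' where "i' = i - length (fib_word (Suc j))"
      have i': "int i = int i' + fibo (Suc j)" "1 \<le> i'" "int i' \<le> fibo j"
        using False len less.prems j fibo_Suc_Suc[of j] by (auto simp: i'_def of_nat_diff)
      have "\<not> i - 1 < length (fib_word (Suc j))" "i - 1 - length (fib_word (Suc j)) = i' - 1"
        using len False by (linarith, simp add: i'_def)
      then have "fib_word k ! (i - 1) = fib_word j ! (i' - 1)"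
        using j by (simp add: nth_append)
      also have "\<dots> = 1 \<longleftrightarrow> (phase N - fibo N * int i') mod fibo (Suc N) < fibo N"
        using less.prems j i' by (intro less.IH) auto
      also have "\<dots> \<longleftrightarrow> (phase N - fibo N * int i) mod fibo (Suc N) < fibo N"
        unfolding i'(1) using less.prems j i' by (intro rotation_letter_period[symmetric]) auto
      finally show ?thesis .
    qed
  qed
qed

lemma cyclic_fib_word_rotation:
  assumes "1 \<le> N"
  shows "cyclic_fib_word (Suc N) i = 1 \<longleftrightarrow>
    (phase N - fibo N * i) mod fibo (Suc N) < fibo N"
proof -
  let ?m = "fibo (Suc N)"
  define q where "q = (i - 1) mod ?m"
  have q: "0 \<le> q" "q < ?m" using fibo_pos[of "Suc N"] by (auto simp: q_def)
  have "[q + 1 = i] (mod ?m)" by (simp add: q_def cong_def mod_add_left_eq)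
  then have "[phase N - fibo N * (q + 1) = phase N - fibo N * i] (mod ?m)"
    by (intro cong_diff cong_mult cong_refl)
  then show ?thesis
    using fib_word_rotation[of "Suc N" N "nat q + 1"] assms q
    by (simp add: cyclic_fib_word_def q_def[symmetric] cong_def add.commute)
qed

section \<open>Matching pairs of positions\<close>

text \<open>A pair in the set is determined by its second component.\<close>

lemma card_match_pairs_diff:
  assumes "1 < m" and periodic: "\<And>x. w (x mod m) = w x"
  shows "card (match_pairs_diff m w s (d mod m)) =
    card {k \<in> {0..<m}. \<forall>t<s. w (k + d + int t) = w (k + int t)}" (is "_ = card ?K")
proof -
  interpret residues m "residue_ring m" using assms(1) by unfold_locales auto
  have shift: "w (x \<oplus>\<^bsub>residue_ring m\<^esub> (y mod m)) = w (x + y)" for x y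
    using periodic by (simp add: res_add_eq mod_add_right_eq)
  have minus: "x \<ominus>\<^bsub>residue_ring m\<^esub> y = (x - y) mod m" for x y
    by (simp add: a_minus_def res_add_eq res_neg_eq mod_add_right_eq)
  have window: "(\<forall>t\<in>{1..s}. P (int t - 1)) \<longleftrightarrow> (\<forall>t<s. P (int t))" for P :: "int \<Rightarrow> bool"
  proof
    assume *: "\<forall>t\<in>{1..s}. P (int t - 1)"
    show "\<forall>t<s. P (int t)" using *[rule_format, of "Suc _"] by auto
  next
    assume *: "\<forall>t<s. P (int t)"
    show "\<forall>t\<in>{1..s}. P (int t - 1)"
    proof
      fix t assume "t \<in> {1..s}"
      then obtain r where "t = Suc r" "r < s" by (cases t) auto
      then show "P (int t - 1)" using * by simp
    qed
  qed
  have member: "(x, k) \<in> match_pairs_diff m w s (d mod m) \<longleftrightarrow>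
      x \<in> {0..<m} \<and> k \<in> {0..<m} \<and> (\<forall>t<s. w (x + int t) = w (k + int t)) \<and> (x - k) mod m = d mod m" for x k
    using window[of "\<lambda>t. w (x + t) = w (k + t)"]
    by (auto simp: match_pairs_diff_def match_pairs_def shift minus res_carrier_eq)
  have "match_pairs_diff m w s (d mod m) = (\<lambda>k. ((k + d) mod m, k)) ` ?K"
  proof (intro equalityI subsetI)
    fix z assume "z \<in> match_pairs_diff m w s (d mod m)"
    then obtain x k where z: "z = (x, k)" "0 \<le> x" "x < m" "0 \<le> k" "k < m"
      and eq: "\<forall>t<s. w (x + int t) = w (k + int t)" and d: "(x - k) mod m = d mod m"
      by (cases z) (auto simp: member)
    have "x = (k + d) mod m"
      using cong_add[of "x - k" d m k k] d z by (simp add: cong_def add.commute)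
    moreover from this have "w (x + t) = w (k + d + t)" for t
      using periodic[of "x + t"] periodic[of "k + d + t"] by (simp add: mod_add_left_eq)
    ultimately show "z \<in> (\<lambda>k. ((k + d) mod m, k)) ` ?K" using z eq by auto
  next
    fix z assume "z \<in> (\<lambda>k. ((k + d) mod m, k)) ` ?K"
    then obtain k where k: "z = ((k + d) mod m, k)" "0 \<le> k" "k < m"
      "\<forall>t<s. w (k + d + int t) = w (k + int t)" by auto
    have "w ((k + d) mod m + t) = w (k + d + t)" for t
      using periodic[of "(k + d) mod m + t"] periodic[of "k + d + t"] by (simp add: mod_add_left_eq)
    then show "z \<in> match_pairs_diff m w s (d mod m)" using k assms(1)
      by (auto simp: member mod_diff_left_eq)
  qed
  then show ?thesis by (simp add: card_image inj_on_def)
qed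

text \<open>The coordinate change \<open>g\<close> is a bijection since consecutive Fibonacci numbers are coprime. It
  turns the shift by \<open>f\<^sub>N p\<close> into the shift by \<open>- f\<^sub>N\<^sup>2 p \<equiv> \<plusminus>p\<close>. The sign disappears at the end, because
  the count is symmetric in \<open>p\<close> and \<open>f\<^sub>N\<^sub>+\<^sub>1 - p\<close>.\<close>

lemma card_match_pairs_cyclic_fib_word:
  assumes "1 \<le> N" "0 \<le> p" "p \<le> fibo (Suc N)"
    and gaps: "rotation_gaps (fibo (Suc N)) (fibo N) A B u v s"
  shows "card (match_pairs_diff (fibo (Suc N)) (cyclic_fib_word (Suc N)) s
      ((fibo N * p) mod fibo (Suc N))) =
    rotation_gaps.pairs_at (fibo (Suc N)) (fibo N) s p +
    rotation_gaps.pairs_at (fibo (Suc N)) (fibo N) s (fibo (Suc N) - p)"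
proof -
  let ?m = "fibo (Suc N)" and ?a = "fibo N" and ?w = "cyclic_fib_word (Suc N)"
  interpret rotation_gaps ?m ?a A B u v s by (rule gaps)
  have am: "0 \<le> ?a" "?a < ?m" "1 < ?m"
    using fibo_pos[of N] fibo_less_Suc[of N] assms by auto
  define p' where "p' = (if even N then ?m - p else p)"
  have p': "0 \<le> p'" "p' \<le> ?m" "pairs_at p' + pairs_at (?m - p') = pairs_at p + pairs_at (?m - p)"
    using assms by (auto simp: p'_def)
  have square: "[?a * (?a * p) = - p'] (mod ?m)"
  proof -
    have "[?a * ?a * p = (-1) ^ N * p] (mod ?m)"
      using cong_mult[OF fibo_mult_cong[of N N] cong_refl] by (simp add: fibo_0)
    then show ?thesis by (auto simp: p'_def cong_def mult.assoc)
  qed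
  define g where "g k = (phase N - ?a * k) mod ?m" for k
  have "inj_on g {0..<?m}"
  proof (rule inj_onI)
    fix j k assume jk: "j \<in> {0..<?m}" "k \<in> {0..<?m}" "g j = g k"
    then have "[?a * j = ?a * k] (mod ?m)"
      using cong_diff[OF cong_refl, of "phase N - ?a * j" "phase N - ?a * k" ?m "phase N"]
      by (simp add: g_def cong_def)
    moreover have "coprime ?a ?m"
      using coprime_fib_Suc_nat[of "Suc N"] by (simp add: fibo_def del: fib.simps)
    ultimately have "[j = k] (mod ?m)" by (simp add: cong_mult_lcancel)
    then show "j = k" using jk by (simp add: cong_def)
  qed
  moreover have "g ` {0..<?m} \<subseteq> {0..<?m}" using m_pos by (auto simp: g_def)
  ultimately have g_bij: "bij_betw g {0..<?m} {0..<?m}"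
    by (simp add: bij_betw_def endo_inj_surj)
  have letter: "?w (k + int t) = 1 \<longleftrightarrow> (g k - ?a * int t) mod ?m < ?a"
    and shifted_letter: "?w (k + ?a * p + int t) = 1 \<longleftrightarrow> ((g k + p') mod ?m - ?a * int t) mod ?m < ?a" for k t
  proof -
    show "?w (k + int t) = 1 \<longleftrightarrow> (g k - ?a * int t) mod ?m < ?a"
      unfolding cyclic_fib_word_rotation[OF assms(1)] g_def mod_diff_left_eq
      by (simp add: algebra_simps)
    have "[phase N - ?a * (k + ?a * p + int t) = phase N - ?a * k - ?a * int t + p'] (mod ?m)"
      using cong_diff[OF cong_refl square, of "phase N - ?a * k - ?a * int t"]
      by (simp add: algebra_simps)
    moreover have "((g k + p') mod ?m - ?a * int t) mod ?m = (phase N - ?a * k - ?a * int t + p') mod ?m"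
      unfolding g_def mod_diff_left_eq mod_add_left_eq by (simp add: mod_simps algebra_simps)
    ultimately show "?w (k + ?a * p + int t) = 1 \<longleftrightarrow> ((g k + p') mod ?m - ?a * int t) mod ?m < ?a"
      unfolding cyclic_fib_word_rotation[OF assms(1)] by (simp add: cong_def)
  qed
  have bit_eq: "x = y \<longleftrightarrow> (x = 1 \<longleftrightarrow> y = 1)" for x y :: bit
    by (cases x; cases y) auto
  have match: "(\<forall>t<s. ?w (k + ?a * p + int t) = ?w (k + int t)) \<longleftrightarrow> same_gap (g k) ((g k + p') mod ?m)" for k
  proof -
    have "?w (k + ?a * p + int t) = ?w (k + int t) \<longleftrightarrow>
      ((g k - ?a * int t) mod ?m < ?a \<longleftrightarrow> ((g k + p') mod ?m - ?a * int t) mod ?m < ?a)" for t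
      by (subst bit_eq, subst shifted_letter, subst letter) (rule eq_commute)
    then have "(\<forall>t<s. ?w (k + ?a * p + int t) = ?w (k + int t)) \<longleftrightarrow> (\<forall>t<s.
      (g k - ?a * int t) mod ?m < ?a \<longleftrightarrow> ((g k + p') mod ?m - ?a * int t) mod ?m < ?a)"
      by (simp only:)
    also have "\<dots> \<longleftrightarrow> same_gap (g k) ((g k + p') mod ?m)"
      unfolding same_gap_def using am m_pos
      by (intro same_factor_iff_same_cuts) (simp_all add: g_def)
    finally show ?thesis .
  qed
  have periodic: "?w (x mod ?m) = ?w x" for x
    by (simp add: cyclic_fib_word_def mod_diff_left_eq)
  have "card (match_pairs_diff ?m ?w s ((?a * p) mod ?m))
      = card {k \<in> {0..<?m}. same_gap (g k) ((g k + p') mod ?m)}"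
    unfolding card_match_pairs_diff[where w = ?w, OF am(3) periodic] match ..
  also have "\<dots> = card {x \<in> {0..<?m}. same_gap x ((x + p') mod ?m)}"
  proof (rule bij_betw_same_card)
    show "bij_betw g {k \<in> {0..<?m}. same_gap (g k) ((g k + p') mod ?m)}
        {x \<in> {0..<?m}. same_gap x ((x + p') mod ?m)}"
    proof (rule bij_betw_subset[OF g_bij])
      have "x \<in> g ` {0..<?m}" if "x \<in> {0..<?m}" for x
        using g_bij that by (simp add: bij_betw_def)
      moreover have "g k \<in> {0..<?m}" for k using m_pos by (simp add: g_def)
      ultimately show "g ` {k \<in> {0..<?m}. same_gap (g k) ((g k + p') mod ?m)}
          = {x \<in> {0..<?m}. same_gap x ((x + p') mod ?m)}" by blast
    qed auto
  qed
  also have "\<dots> = pairs_at p + pairs_at (?m - p)"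
    using cyclic_pairs_eq[of p'] p' by simp
  finally show ?thesis .
qed

theorem theorem2p4:
  fixes n l s :: nat and p :: int
  assumes "1 < fibo l" and "fibo l \<le> int s" and "int s < fibo (l + 1)"
    and "fibo (l + 1) < fibo n"
    and "0 \<le> p" and "p < fibo n"
  defines "N \<equiv> int (card (match_pairs_diff (fibo n) (cyclic_fib_word n) s
                             (residue_class (fibo n) (fibo (n - 1) * p))))"
  shows
    "(0 \<le> p \<and> p < fibo (n - l - 1) \<longrightarrow>
        N = fibo n - p * (int s + 1)) \<and>
     (fibo (n - l - 1) \<le> p \<and> p < fibo (n - l) \<longrightarrow>
        N = fibo (n - l - 1) * (fibo (l + 1) - (int s + 1)) + fibo l * (fibo (n - l) - p)) \<and>
     (fibo (n - l) \<le> p \<and> p < fibo (n - l + 1) \<longrightarrow>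
        N = (fibo (l + 1) - (int s + 1)) * (fibo (n - l + 1) - p)) \<and>
     (fibo (n - l + 1) \<le> p \<and> p \<le> fibo n - fibo (n - l + 1) \<longrightarrow>
        N = 0) \<and>
     (fibo n - fibo (n - l + 1) \<le> p \<and> p \<le> fibo n - fibo (n - l) \<longrightarrow>
        N = (fibo (l + 1) - (int s + 1)) * (fibo (n - l + 1) - (fibo n - p))) \<and>
     (fibo n - fibo (n - l) < p \<and> p \<le> fibo n - fibo (n - l - 1) \<longrightarrow>
        N = fibo (n - l - 1) * (fibo (l + 1) - (int s + 1)) + fibo l * (fibo (n - l) - (fibo n - p))) \<and>
     (fibo n - fibo (n - l - 1) < p \<and> p < fibo n \<longrightarrow>
        N = fibo n - (fibo n - p) * (int s + 1))"
proof -
  have l2: "2 \<le> l"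
    using assms(1) fibo_mono[of l 1] fibo_1 by (cases "l \<le> 1") auto
  have ln: "l + 1 < n"
    using assms(4) fibo_mono[of n "l + 1"] by (cases "n \<le> l + 1") auto
  define M where "M = n - 1"
  define A where "A = fibo (n - l - 1)"
  define B where "B = fibo (n - l)"
  define F where "F = fibo l"
  define L where "L = fibo (l + 1) - (int s + 1)"
  have n: "n = Suc M" "l \<le> M" "M - l = n - l - 1" "Suc (n - l - 1) = n - l"
    using ln by (auto simp: M_def)
  have C: "fibo (n - l + 1) = A + B"
    using fibo_Suc_Suc[of "n - l - 1"] ln by (simp add: A_def B_def Suc_diff_Suc)
  have AB: "0 < A" "A \<le> B"
    using fibo_pos fibo_mono[of "n - l - 1" "n - l"] by (auto simp: A_def B_def)
  have prev: "int (fib l) = fibo (l + 1) - F" and fib_Suc: "int (fib (Suc l)) = F"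
    by (auto simp: F_def fibo_def)
  have total: "fibo n = F * B + (fibo (l + 1) - F) * A"
  proof -
    have "fibo (l - 1) = fibo (l + 1) - F"
      using fibo_Suc_Suc[of "l - 1"] l2 by (simp add: F_def)
    then show ?thesis
      using fibo_total[of l M] n(2) l2 unfolding n(3,4) n(1)[symmetric] by (simp add: A_def B_def F_def)
  qed
  define T where "T q = (int s + 1 - F) * max 0 (A - q) + (F - L) * max 0 (B - q)
    + L * max 0 (A + B - q)" for q
  have N: "N = T p + T (fibo n - p)"
  proof (cases "even l")
    case True
    have gaps: "rotation_gaps (fibo n) (fibo M) A B (fib (Suc l)) (fib l) s"
      using rotation_gaps_even[of l M s, unfolded n(3,4) n(1)[symmetric]] True assms(2,3) n(2) l2
      by (simp add: A_def B_def)
    have "int (rotation_gaps.pairs_at (fibo n) (fibo M) s q) = T q" if "0 \<le> q" for q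
      unfolding rotation_gaps.pairs_at_eq[OF gaps that] T_def prev fib_Suc
      by (simp add: L_def algebra_simps)
    then show ?thesis
      using card_match_pairs_cyclic_fib_word[OF _ _ _ gaps[unfolded n(1)], of p, folded n(1)]
        assms(5,6) n(2) l2
      by (simp add: N_def M_def)
  next
    case False
    have gaps: "rotation_gaps (fibo n) (fibo M) B A (fib l) (fib (Suc l)) s"
      using rotation_gaps_odd[of l M s, unfolded n(3,4) n(1)[symmetric]] False assms(2,3) n(2)
      by (simp add: A_def B_def)
    have "int (rotation_gaps.pairs_at (fibo n) (fibo M) s q) = T q" if "0 \<le> q" for q
      unfolding rotation_gaps.pairs_at_eq[OF gaps that] T_def prev fib_Suc
      by (simp add: L_def algebra_simps)
    then show ?thesis
      using card_match_pairs_cyclic_fib_word[OF _ _ _ gaps[unfolded n(1)], of p, folded n(1)]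
        assms(5,6) n(2) l2
      by (simp add: N_def M_def)
  qed
  \<comment> \<open>On \<open>[0, A]\<close>, \<open>[A, B]\<close>, \<open>[B, A + B]\<close> and beyond, all three, two, one and none of the gap
    lengths contribute.\<close>
  have T_small: "T q = fibo n - q * (int s + 1)" if "q \<le> A" for q
    using that AB by (simp add: T_def total L_def algebra_simps)
  have T_medium: "T q = A * L + F * (B - q)" if "A \<le> q" "q \<le> B" for q
    using that AB by (simp add: T_def algebra_simps)
  have T_large: "T q = L * (A + B - q)" if "B \<le> q" "q \<le> A + B" for q
    using that AB by (simp add: T_def)
  have T_zero: "T q = 0" if "A + B \<le> q" for q
    using that AB by (simp add: T_def)
  \<comment> \<open>At most one of \<open>T p\<close> and \<open>T (f\<^sub>n - p)\<close> is nonzero: for \<open>l \<ge> 3\<close> because twice the longest gap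
    fits into \<open>f\<^sub>n\<close>, while for \<open>l = 2\<close> the condition on \<open>s\<close> forces \<open>s = 2\<close>, so that there is no gap
    of length \<open>A + B\<close>.\<close>
  have wrap: "T (fibo n - q) = 0" if "q \<le> A + B" for q
  proof (cases "l = 2")
    case True
    then have "F = 2" "L = 0" "fibo (l + 1) = 3"
      using assms(2,3) by (auto simp: F_def L_def fibo_def numeral_2_eq_2 numeral_3_eq_3)
    then show ?thesis
      using T_large[of "fibo n - q"] T_zero[of "fibo n - q"] that total AB by (cases "fibo n - q \<le> A + B") auto
  next
    case False
    have "3 \<le> F"
      using False l2 fibo_mono[of 3 l]
      by (auto simp: F_def fibo_def numeral_eq_Suc)
    have "2 \<le> fibo (l + 1) - F"
      using False l2 fibo_mono[of 2 "l - 1"] fibo_Suc_Suc[of "l - 1"]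
      by (auto simp: F_def fibo_def numeral_eq_Suc)
    then have "2 * B \<le> F * B" "2 * A \<le> (fibo (l + 1) - F) * A"
      using AB \<open>3 \<le> F\<close> by (auto intro!: mult_right_mono)
    then show ?thesis using T_zero[of "fibo n - q"] that total by linarith
  qed
  have low: "N = T p" if "p \<le> A + B" using N wrap that by simp
  have high: "N = T (fibo n - p)" if "fibo n - p \<le> A + B"
    using N wrap[of "fibo n - p"] that by simp
  note fold = C A_def[symmetric] B_def[symmetric] F_def[symmetric] L_def[symmetric]
  show ?thesis
    unfolding fold
    using low high N T_small[of p] T_medium[of p] T_large[of p] T_zero[of p]
      T_small[of "fibo n - p"] T_medium[of "fibo n - p"] T_large[of "fibo n - p"]
      T_zero[of "fibo n - p"] AB
    by (auto simp: not_less not_le)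
qed

end
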